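(* Let $0<r\le1$ and $0<u\le1$, and consider the two-ball, three-box multi-look search-cost game with box costs $(a,b,c)=(1,r,ru)$. Suppose $A_3\ge0$ and $B_3\ge0$, where $$A_3=r^2u^4+2r^2u^3+r^2u^2+2r^2u+r^2+ru^3+r-u^2-u-1,$$ $$B_3=r^2u^2+r^2u-r^2+ru+r-1.$$ Let $$X=r^2u^2+3r^2u+r^2-2ru^2-ru+r-1,$$ $$Y=-2r^4u^3-6r^4u^2-2r^4u+2r^4+2r^3u^3-r^3u^2-5r^3u-r^3+r^2u^2+2r^2u+2r^2+ru+2r+1,$$ $$Z=r^2u^2+r^2u+r^2-ru+r-1.$$ The following four cases cover the region $\{A_3\ge0,\ B_3\ge0\}$, and in each case there is a Searcher mixture on the indicated support (set of policies) that has nonnegative weights summing to one and equalizes all six Hider placements at $V_3$ (i.e. has expected cost exactly $V_3$ against every $x\in\mathcal H$): - Case A: $Y\ge0$, $X\ge0$; support $\{2,26,28,33,37,40\}$. - Case B: $Y\le0$; support $\{2,3,22,26,37,40\}$. - Case C: $Y\ge0$, $X\le0$, $Z\ge0$; support $\{2,5,28,33,37,40\}$. - Case D: $Y\ge0$, $X\le0$, $Z\le0$; support $\{5,19,28,33,37,40\}$.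
   Context: The game. There are three boxes $A,B,C$ with search costs $a,b,c$ respectively. The Hider places two identical balls in the boxes; the placements are $\mathcal H=\{002,011,020,101,110,200\}$, where $x=x_1x_2x_3$ has $x_1,x_2,x_3$ balls in $A,B,C$ respectively. The Searcher opens boxes one at a time, each opening costing that box's search cost. If the opened box currently contains at least one ball, exactly one ball is recovered (removed) and she observes only "success"; otherwise she observes "failure", so she learns that the box is empty. The cost $C_s(x)$ of a deterministic adaptive policy $s$ against placement $x$ is the total cost paid until both balls are found. A Searcher mixture with weights $w_s$ on policies $s$ has expected cost $\sum_s w_sC_s(x)$ against $x$; a mixture on an indicated support gives weight only to policies in that set (weights may be zero). The value $V_3$ (evaluated at $(a,b,c)=(1,r,ru)$). Put $T_2=a^2+b^2+c^2+ab+ac+bc$ and $T_3=a^3+b^3+c^3+a^2b+a^2c+ab^2+b^2c+ac^2+bc^2+abc$; then $V_3=2T_3/T_2$. Policy notation. $i\mid\sigma\mid R_{jk}$ or $i\mid\sigma\mid S_{jk}$ (with $\{i,j,k\}=\{A,B,C\}$ and $\sigma$ an ordering of the boxes) denotes the following policy. First open box $i$. If this succeeds, inspect the boxes in the order $\sigma$ until the remaining ball is found. If the first opening fails, open $j$ next. If the opening of $j$ succeeds, then under $R_{jk}$ open $j$ again (and, if that fails, open $k$), while under $S_{jk}$ open $k$ (and, if that fails, open $j$). If the opening of $j$ fails, open $k$ twice. The numbered policies are: 2: $C\mid CBA\mid R_{AB}$; 3: $C\mid CAB\mid R_{BA}$; 5: $C\mid CAB\mid R_{AB}$; 19: $A\mid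 ABC\mid R_{CB}$; 22: $B\mid CAB\mid S_{AC}$; 26: $B\mid BCA\mid R_{AC}$; 28: $A\mid CBA\mid S_{BC}$; 33: $A\mid ABC\mid S_{BC}$; 37: $A\mid CAB\mid R_{BC}$; 40: $A\mid BAC\mid R_{BC}$. *)

theory Defs
  imports Complex_Main
begin

datatype box = A | B | C

text \<open>A placement gives the number of balls in each box; \<open>place x1 x2 x3\<close> is written
  \<open>x1x2x3\<close> on paper.\<close>

type_synonym placement = "box \<Rightarrow> nat"

fun place :: "nat \<Rightarrow> nat \<Rightarrow> nat \<Rightarrow> placement" where
  "place x1 x2 x3 A = x1"
| "place x1 x2 x3 B = x2"
| "place x1 x2 x3 C = x3"

definition placements :: "placement set" where
  "placements = {place 0 0 2, place 0 1 1, place 0 2 0, place 1 0 1, place 1 1 0, place 2 0 0}"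

fun box_cost :: "real \<Rightarrow> real \<Rightarrow> real \<Rightarrow> box \<Rightarrow> real" where
  "box_cost a b c A = a"
| "box_cost a b c B = b"
| "box_cost a b c C = c"

text \<open>A deterministic adaptive policy is a decision tree: \<open>Open i s f\<close> opens box \<open>i\<close> and
  continues with \<open>s\<close> after a success and with \<open>f\<close> after a failure.  The search ends as soon as
  the last ball is recovered, whatever tree is left.  \<open>Stop\<close> abandons the search; it is meant only
  for branches that no placement reaches with a ball still hidden, which \<open>finds_all\<close> expresses.
  Only for policies with that property is \<open>search_cost\<close> the cost of finding all balls.\<close>

datatype policy = Stop | Open box policy policy

fun search_cost :: "(box \<Rightarrow> real) \<Rightarrow> policy \<Rightarrow> placement \<Rightarrow> real" where
  "search_cost q Stop x = 0"
| "search_cost q (Open i s f) x =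
    (if \<forall>j. x j = 0 then 0
     else q i + (if x i > 0 then search_cost q s (x(i := x i - 1)) else search_cost q f x))"

fun finds_all :: "policy \<Rightarrow> placement \<Rightarrow> bool" where
  "finds_all Stop x \<longleftrightarrow> (\<forall>j. x j = 0)"
| "finds_all (Open i s f) x \<longleftrightarrow>
    (\<forall>j. x j = 0) \<or> (if x i > 0 then finds_all s (x(i := x i - 1)) else finds_all f x)"

text \<open>Opens the listed boxes in turn until one ball is found.\<close>

fun inspect :: "box list \<Rightarrow> policy" where
  "inspect [] = Stop"
| "inspect (i # is) = Open i Stop (inspect is)"

text \<open>\<open>policy_R i \<sigma> j k\<close> and \<open>policy_S i \<sigma> j k\<close> are written
  \<open>i | \<sigma> | R\<^sub>j\<^sub>k\<close> and \<open>i | \<sigma> | S\<^sub>j\<^sub>k\<close> on paper.\<close>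

definition policy_R :: "box \<Rightarrow> box list \<Rightarrow> box \<Rightarrow> box \<Rightarrow> policy" where
  "policy_R i \<sigma> j k =
    Open i (inspect \<sigma>) (Open j (inspect [j, k]) (Open k (Open k Stop Stop) Stop))"

definition policy_S :: "box \<Rightarrow> box list \<Rightarrow> box \<Rightarrow> box \<Rightarrow> policy" where
  "policy_S i \<sigma> j k =
    Open i (inspect \<sigma>) (Open j (inspect [k, j]) (Open k (Open k Stop Stop) Stop))"

definition "policy2 = policy_R C [C, B, A] A B"
definition "policy3 = policy_R C [C, A, B] B A"
definition "policy5 = policy_R C [C, A, B] A B"
definition "policy19 = policy_R A [A, B, C] C B"
definition "policy22 = policy_S B [C, A, B] A C"
definition "policy26 = policy_R B [B, C, A] A C"
definition "policy28 = policy_S A [C, B, A] B C"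
definition "policy33 = policy_S A [A, B, C] B C"
definition "policy37 = policy_R A [C, A, B] B C"
definition "policy40 = policy_R A [B, A, C] B C"

lemma numbered_policies_find_all:
  assumes "s \<in> {policy2, policy3, policy5, policy19, policy22,
                policy26, policy28, policy33, policy37, policy40}"
    and "x \<in> placements"
  shows "finds_all s x"
proof -
  have all_box: "(\<forall>j. P j) \<longleftrightarrow> P A \<and> P B \<and> P C" for P :: "box \<Rightarrow> bool"
    by (metis box.exhaust)
  show ?thesis
    using assms
    by (auto simp: placements_def all_box policy_R_def policy_S_def policy2_def policy3_def
      policy5_def policy19_def policy22_def policy26_def policy28_def policy33_def
      policy37_def policy40_def)
qed

definition is_mixture_on :: "policy set \<Rightarrow> (policy \<Rightarrow> real) \<Rightarrow> bool" where
  "is_mixture_on S w \<longleftrightarrow>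
    finite S \<and> (\<forall>s\<in>S. w s \<ge> 0) \<and> (\<forall>s. s \<notin> S \<longrightarrow> w s = 0) \<and> (\<Sum>s\<in>S. w s) = 1"

definition expected_cost ::
    "(box \<Rightarrow> real) \<Rightarrow> policy set \<Rightarrow> (policy \<Rightarrow> real) \<Rightarrow> placement \<Rightarrow> real" where
  "expected_cost q S w x = (\<Sum>s\<in>S. w s * search_cost q s x)"

definition T2 :: "real \<Rightarrow> real \<Rightarrow> real \<Rightarrow> real" where
  "T2 a b c = a^2 + b^2 + c^2 + a*b + a*c + b*c"

definition T3 :: "real \<Rightarrow> real \<Rightarrow> real \<Rightarrow> real" where
  "T3 a b c = a^3 + b^3 + c^3 + a^2*b + a^2*c + a*b^2 + b^2*c + a*c^2 + b*c^2 + a*b*c"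

definition V3 :: "real \<Rightarrow> real \<Rightarrow> real \<Rightarrow> real" where
  "V3 a b c = 2 * T3 a b c / T2 a b c"

definition has_equalizing_mixture :: "real \<Rightarrow> real \<Rightarrow> real \<Rightarrow> policy set \<Rightarrow> bool" where
  "has_equalizing_mixture a b c S \<longleftrightarrow>
    (\<exists>w. is_mixture_on S w \<and>
      (\<forall>x\<in>placements. expected_cost (box_cost a b c) S w x = V3 a b c))"

end

theory Submission
  imports Defs
begin

text \<open>
  For each of the four supports the requirement that all six placements cost the same, together
  with normalization, is a linear system for six weights.  Cramer's rule solves it: every weight is
  a quotient \<open>n\<^sub>s / (k * T\<^sub>2)\<close> of polynomials in \<open>r\<close> and \<open>u\<close>, with one positive denominator per
  support.  That these weights equalize at \<open>V\<^sub>3\<close> is then a polynomial identity, and what needs an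
  argument is that the numerators are nonnegative.  Some of them are positive multiples of
  \<open>A3\<close>, \<open>B3\<close>, \<open>Y\<close>, \<open>\<plusminus>X\<close> or \<open>\<plusminus>Z\<close>, which is how these polynomials come to delimit the cases.

  The other numerators are controlled by the triangle inequality \<open>a \<le> b + c\<close> between the box costs
  \<open>a = 1\<close>, \<open>b = r\<close>, \<open>c = r*u\<close>, which follows from \<open>A3 \<ge> 0\<close> and \<open>B3 \<ge> 0\<close>
  (\<open>triangle_inequality\<close>).  The cost vectors with \<open>c \<le> b \<le> a \<le> b + c\<close> form a simplicial cone with
  coordinates \<open>x = a - b\<close>, \<open>y = b + c - a\<close>, \<open>z = b - c\<close>, where \<open>a = 2*x + y + z\<close>.  A numerator,
  multiplied by \<open>b = r\<close> if it contains a monomial with more factors \<open>u\<close> than \<open>r\<close>, is homogeneous in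
  \<open>a, b, c\<close> after inserting powers of \<open>a = 1\<close>, hence a form in \<open>x, y, z\<close>.  For many numerators all
  coefficients of this form are nonnegative, which settles their sign.

  The remaining numerators are nonnegative only on a part of the cone.  There the sign condition
  of the case is replaced by a linear consequence:
  \<open>Y \<le> 0\<close> gives \<open>4*a \<le> 2*b + 3*c\<close>, \<open>X \<le> 0\<close> gives \<open>5*b \<le> 3*a + c\<close>, and \<open>Z \<le> 0\<close> gives
  \<open>9*b + c \<le> 6*a\<close>.  Each of these cuts a smaller simplicial cone out of the first one, and in the
  coordinates of the smaller cone the coefficients are again nonnegative.\<close>

section \<open>Mixtures from weights with a common denominator\<close>

definition placement_list :: "placement list" where
  "placement_list =
    [place 0 0 2, place 0 1 1, place 0 2 0, place 1 0 1, place 1 1 0, place 2 0 0]"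

definition costs :: "real \<Rightarrow> real \<Rightarrow> real \<Rightarrow> policy \<Rightarrow> real list" where
  "costs a b c s = map (search_cost (box_cost a b c) s) placement_list"

text \<open>
  Weights enter as a list of pairs of a policy and a numerator, and a policy collects the numerators
  of all its pairs.  So sums over the support become sums over the list without having to know that
  the listed policies are pairwise different.\<close>

lemma equalizing_mixtureI:
  fixes a b c k :: real and ws :: "(policy \<times> real) list"
  assumes "finite S" and support: "fst ` set ws \<subseteq> S"
    and nonneg: "\<forall>n \<in> snd ` set ws. 0 \<le> n"
    and pos: "0 < k" "0 < T2 a b c"
    and total: "(\<Sum>(s, n)\<leftarrow>ws. n) = k * T2 a b c"
    and equal: "\<forall>i<6. (\<Sum>(s, n)\<leftarrow>ws. n * costs a b c s ! i) = 2 * k * T3 a b c"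
  shows "has_equalizing_mixture a b c S"
proof -
  define K where "K = k * T2 a b c"
  have "0 < K" using pos by (simp add: K_def)
  define w where "w s = (\<Sum>(t, n)\<leftarrow>ws. if t = s then n else 0) / K" for s
  have regroup: "(\<Sum>s\<in>S. w s * g s) = (\<Sum>(s, n)\<leftarrow>ws. n * g s) / K" for g
  proof -
    have "(\<Sum>s\<in>S. (\<Sum>(t, n)\<leftarrow>vs. if t = s then n else 0) * g s) = (\<Sum>(s, n)\<leftarrow>vs. n * g s)"
      if "fst ` set vs \<subseteq> S" for vs :: "(policy \<times> real) list"
      using that
    proof (induction vs)
      case (Cons v vs)
      obtain t n where v: "v = (t, n)" by fastforce
      have "(\<Sum>s\<in>S. (if t = s then n else 0) * g s) = (\<Sum>s\<in>S. if t = s then n * g s else 0)"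
        by (rule sum.cong) auto
      also have "\<dots> = n * g t"
        using Cons.prems \<open>finite S\<close> by (simp add: v)
      finally show ?case
        using Cons by (simp add: v distrib_right sum.distrib)
    qed simp
    from this[OF support] show ?thesis
      by (simp add: w_def sum_divide_distrib[symmetric] times_divide_eq_left)
  qed
  have "is_mixture_on S w"
    unfolding is_mixture_on_def
  proof (intro conjI ballI allI impI)
    fix s
    have "0 \<le> (\<Sum>(t, n)\<leftarrow>ws. if t = s then n else 0)"
      using nonneg by (intro sum_list_nonneg) fastforce
    then show "0 \<le> w s" using \<open>0 < K\<close> by (simp add: w_def)
  next
    fix s assume "s \<notin> S"
    then have "(\<Sum>(t, n)\<leftarrow>ws. if t = s then n else 0) = (\<Sum>v\<leftarrow>ws. 0)"
      using support by (intro arg_cong[where f = sum_list] map_cong) auto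
    then show "w s = 0" by (simp add: w_def)
  next
    show "(\<Sum>s\<in>S. w s) = 1"
      using regroup[of "\<lambda>_. 1"] total \<open>0 < K\<close> by (simp flip: K_def)
  qed fact
  moreover have "expected_cost (box_cost a b c) S w x = V3 a b c" if "x \<in> placements" for x
  proof -
    have "x \<in> set placement_list"
      using that by (auto simp: placements_def placement_list_def)
    then obtain i where i: "i < length placement_list" "placement_list ! i = x"
      by (auto simp: in_set_conv_nth)
    then have "costs a b c s ! i = search_cost (box_cost a b c) s x" for s
      by (simp add: costs_def)
    moreover have "i < 6" using i(1) by (simp add: placement_list_def)
    ultimately have "(\<Sum>(s, n)\<leftarrow>ws. n * search_cost (box_cost a b c) s x) = 2 * k * T3 a b c"
      using equal by auto
    then show ?thesis
      using pos by (simp add: expected_cost_def regroup V3_def K_def)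
  qed
  ultimately show ?thesis
    unfolding has_equalizing_mixture_def by blast
qed

lemma all_box: "(\<forall>j. P j) \<longleftrightarrow> P A \<and> P B \<and> P C" for P :: "box \<Rightarrow> bool"
  by (metis box.exhaust)

lemma policy_costs:
  shows "costs a b c policy2 = [2*c, b + 2*c, a + 2*b + c, a + b + 2*c, 2*a + b + c, 2*a + c]"
    and "costs a b c policy3 = [2*c, a + b + 2*c, 2*b + c, a + 2*c, a + 2*b + c, 2*a + b + c]"
    and "costs a b c policy5 = [2*c, a + b + 2*c, a + 2*b + c, a + 2*c, 2*a + b + c, 2*a + c]"
    and "costs a b c policy19 = [a + 2*c, a + b + 2*c, a + 2*b + c, 2*a + b + c, 2*a + b, 2*a]"
    and "costs a b c policy22 = [a + b + 2*c, b + c, a + 2*b + c, a + b + c, a + b + c, 2*a + b + c]"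
    and "costs a b c policy26 = [a + b + 2*c, 2*b + c, 2*b, 2*a + b + c, a + 2*b + c, 2*a + b]"
    and "costs a b c policy28 = [a + b + 2*c, a + b + c, a + 2*b + c, a + c, a + b + c, 2*a + b + c]"
    and "costs a b c policy33 = [a + b + 2*c, a + b + c, a + 2*b + c, 2*a + b + c, 2*a + b, 2*a]"
    and "costs a b c policy37 = [a + b + 2*c, a + 2*b + c, a + 2*b, a + c, 2*a + b + c, 2*a + c]"
    and "costs a b c policy40 = [a + b + 2*c, a + 2*b + c, a + 2*b, 2*a + b + c, a + b, 2*a + b]"
  by (simp_all add: costs_def placement_list_def all_box policy_R_def policy_S_def
      policy2_def policy3_def policy5_def policy19_def policy22_def
      policy26_def policy28_def policy33_def policy37_def policy40_def)

lemma all_less_6: "(\<forall>i<6. P i) \<longleftrightarrow> P 0 \<and> P 1 \<and> P 2 \<and> P 3 \<and> P 4 \<and> P 5" for P :: "nat \<Rightarrow> bool"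
  by (simp add: numeral_eq_Suc All_less_Suc) auto

lemma T2_relative: "T2 1 r (r*u) = 1 + r + r*u + r^2 + r^2*u + r^2*u^2"
  by (simp add: T2_def power2_eq_square)

lemma T3_relative:
  "T3 1 r (r*u) = 1 + r + r*u + r^2 + r^2*u + r^2*u^2 + r^3 + r^3*u + r^3*u^2 + r^3*u^3"
  by (simp add: T3_def power2_eq_square power3_eq_cube)

section \<open>The triangle inequality and linear cuts\<close>

text \<open>
  The curves \<open>A3 = 0\<close> and \<open>B3 = 0\<close> cross on the line \<open>r + r*u = 1\<close>, at the golden ratio
  \<open>u\<^sup>2 + u = 1\<close>: on that line \<open>B3 = r\<^sup>2 * (u\<^sup>2 + u - 1)\<close> and
  \<open>(1 + u)\<^sup>2 * A3 = (u\<^sup>2 - u - 1) * (u\<^sup>2 + u - 1)\<close>, whose first factor is negative.  So below the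
  line \<open>B3 \<ge> 0\<close> forces \<open>u\<^sup>2 + u > 1\<close>, and then \<open>A3\<close>, in which \<open>r\<close> occurs only with
  positive coefficients, is negative.\<close>

lemma triangle_inequality:
  fixes r u :: real
  assumes "0 < r" "0 < u" "u \<le> 1"
    and A3: "0 \<le> r^2*u^4 + 2*r^2*u^3 + r^2*u^2 + 2*r^2*u + r^2 + r*u^3 + r - u^2 - u - 1"
      (is "0 \<le> ?A3")
    and B3: "0 \<le> r^2*u^2 + r^2*u - r^2 + r*u + r - 1"
  shows "1 \<le> r + r*u"
proof (rule ccontr)
  assume "\<not> 1 \<le> r + r*u"
  then have d: "0 < 1 - r*(1 + u)" by (simp add: distrib_left)
  have "r^2*u^2 + r^2*u - r^2 + r*u + r - 1 = r^2*(u^2 + u - 1) - (1 - r*(1 + u))"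
    by algebra
  with B3 d have "0 < r^2*(u^2 + u - 1)" by linarith
  then have "0 < u^2 + u - 1" using \<open>0 < r\<close> by (simp add: zero_less_mult_iff)
  moreover have "u^2 - u - 1 < 0"
  proof -
    have "u * u \<le> u * 1" using assms by (intro mult_left_mono) simp_all
    then show ?thesis unfolding power2_eq_square by linarith
  qed
  ultimately have neg: "(u^2 - u - 1)*(u^2 + u - 1) < 0"
    by (rule mult_neg_pos[rotated])
  define s where "s = r*(1 + u)"
  have s: "0 \<le> s" "s \<le> 1" "s^2 \<le> 1"
    using d assms by (simp_all add: s_def power_le_one)
  \<comment> \<open>\<open>(1 + u)\<^sup>2 * A3\<close> as a quadratic in \<open>s\<close> with nonnegative leading and linear coefficient\<close>
  define p q where "p = u^4 + 2*u^3 + u^2 + 2*u + 1" and "q = u^3 + 1"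
  have "0 \<le> p" "0 \<le> q" using \<open>0 < u\<close> by (simp_all add: p_def q_def)
  have "(1 + u)^2 * ?A3 = p * s^2 + q * (1 + u) * s - (u^2 + u + 1) * (1 + u)^2"
    unfolding p_def q_def s_def by algebra
  also have "\<dots> \<le> p * 1 + q * (1 + u) * 1 - (u^2 + u + 1) * (1 + u)^2"
    using s \<open>0 \<le> p\<close> \<open>0 \<le> q\<close> \<open>0 < u\<close> by (intro diff_right_mono add_mono mult_left_mono) simp_all
  also have "\<dots> = (u^2 - u - 1)*(u^2 + u - 1)"
    unfolding p_def q_def by algebra
  finally have "(1 + u)^2 * ?A3 < 0"
    using neg by linarith
  with A3 show False by (simp add: mult_less_0_iff)
qed

text \<open>
  As a form in \<open>x, y, z\<close>, the polynomial \<open>Y\<close> has a single negative coefficient, that of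
  \<open>y\<^sup>4\<close>.  So \<open>Y \<le> 0\<close> makes \<open>y\<close> large compared with \<open>x\<close> and \<open>z\<close>; the claim is
  \<open>3*x + 2*z \<le> y\<close>.  If \<open>d = 3*x + 2*z - y\<close> were positive, substituting \<open>3*x + 2*z - d\<close> for one
  factor of \<open>y\<^sup>4\<close>, and again in the negative terms that this leaves, would turn \<open>Y\<close> into a form in
  \<open>d, x, y, z\<close> with positive coefficients only.\<close>

lemma cut_of_Y_nonpos:
  fixes r u :: real
  assumes "0 < r" "r \<le> 1" "u \<le> 1" "1 \<le> r + r*u"
    and Y: "- 2*r^4*u^3 - 6*r^4*u^2 - 2*r^4*u + 2*r^4 + 2*r^3*u^3 - r^3*u^2 - 5*r^3*u
              - r^3 + r^2*u^2 + 2*r^2*u + 2*r^2 + r*u + 2*r + 1 \<le> 0" (is "?Y \<le> 0")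
  shows "0 \<le> 2*r + 3*r*u - 4"
proof (rule ccontr)
  define x y z where "x = 1 - r" and "y = r + r*u - 1" and "z = r - r*u"
  define d where "d = 3*x + 2*z - y"
  have nonneg: "0 \<le> x" "0 \<le> y" "0 \<le> z"
    using assms by (simp_all add: x_def y_def z_def)
  assume "\<not> 0 \<le> 2*r + 3*r*u - 4"
  then have "0 < d" by (simp add: d_def x_def y_def z_def)
  then have "x \<noteq> 0 \<or> z \<noteq> 0"
    using \<open>0 \<le> y\<close> by (auto simp: d_def)
  then have pos: "0 < 42*x^4 + 6*z^4"
    using nonneg by (auto intro: add_pos_nonneg add_nonneg_pos)
  have "0 < (42*x^4 + 6*z^4) + (d*(4*y^3 + 10*x*y^2 + 8*y^2*z) +
      (85*x^3*y + 83*x^3*z + 20*x^2*y^2 + 121*x^2*y*z + 73*x^2*z^2 + 77*x*y*z^2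
       + 33*x*z^3 + 2*y^2*z^2 + 20*y*z^3))"
    using nonneg \<open>0 < d\<close> by (intro add_pos_nonneg[OF pos]) simp
  also have "\<dots> = ?Y"
    unfolding d_def x_def y_def z_def by algebra
  finally show False
    using Y by simp
qed

text \<open>
  Here \<open>r * X\<close> is a cubic form in \<open>x, y, z\<close> whose negative terms are those in \<open>x\<^sup>3\<close> and
  \<open>x\<^sup>2*y\<close>, so \<open>X \<le> 0\<close> makes \<open>x\<close> large: the claim is \<open>y + 2*z \<le> 2*x\<close>.
  The argument is the one for \<open>Y\<close>; the factor 8 clears the denominators that come from
  substituting for \<open>x\<close>.\<close>

lemma cut_of_X_nonpos:
  fixes r u :: real
  assumes "0 < r" "r \<le> 1" "u \<le> 1" "1 \<le> r + r*u"
    and X: "r^2*u^2 + 3*r^2*u + r^2 - 2*r*u^2 - r*u + r - 1 \<le> 0" (is "?X \<le> 0")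
  shows "0 \<le> 3 - 5*r + r*u"
proof (rule ccontr)
  define x y z where "x = 1 - r" and "y = r + r*u - 1" and "z = r - r*u"
  define d where "d = y + 2*z - 2*x"
  have nonneg: "0 \<le> x" "0 \<le> y" "0 \<le> z"
    using assms by (simp_all add: x_def y_def z_def)
  assume "\<not> 0 \<le> 3 - 5*r + r*u"
  then have "0 < d" by (simp add: d_def x_def y_def z_def)
  then have "0 < y \<or> 0 < z"
    using \<open>0 \<le> x\<close> by (auto simp: d_def)
  then have pos: "0 < 15*y^3 + 8*z^3"
    using nonneg by (auto intro: add_pos_nonneg add_nonneg_pos)
  have "0 < (15*y^3 + 8*z^3) + (d*(12*x^2 + 18*x*y + 4*x*z + y^2)
      + (32*x*y*z + 24*x*z^2 + 46*y^2*z + 40*y*z^2))"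
    using nonneg \<open>0 < d\<close> by (intro add_pos_nonneg[OF pos]) simp
  also have "\<dots> = 8 * (r * ?X)"
    unfolding d_def x_def y_def z_def by algebra
  finally show False
    using X \<open>0 < r\<close> by (simp add: zero_less_mult_iff)
qed

text \<open>
  The only negative term of \<open>Z\<close> as a form in \<open>x, y, z\<close> is \<open>- x\<^sup>2\<close>; the claim is
  \<open>4*y + 3*z \<le> 2*x\<close>.\<close>

lemma cut_of_Z_nonpos:
  fixes r u :: real
  assumes "0 < r" "r \<le> 1" "u \<le> 1" "1 \<le> r + r*u"
    and Z: "r^2*u^2 + r^2*u + r^2 - r*u + r - 1 \<le> 0" (is "?Z \<le> 0")
  shows "0 \<le> 6 - 9*r - r*u"
proof (rule ccontr)
  define x y z where "x = 1 - r" and "y = r + r*u - 1" and "z = r - r*u"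
  define d where "d = 4*y + 3*z - 2*x"
  have nonneg: "0 \<le> x" "0 \<le> y" "0 \<le> z"
    using assms by (simp_all add: x_def y_def z_def)
  assume "\<not> 0 \<le> 6 - 9*r - r*u"
  then have "0 < d" by (simp add: d_def x_def y_def z_def)
  then have "y \<noteq> 0 \<or> z \<noteq> 0"
    using \<open>0 \<le> x\<close> by (auto simp: d_def)
  then have pos: "0 < 8*y^2 + z^2"
    using nonneg by (auto intro: add_pos_nonneg add_nonneg_pos)
  have "0 < (8*y^2 + z^2) + (d*(2*x + z) + (4*y*z))"
    using nonneg \<open>0 < d\<close> by (intro add_pos_nonneg[OF pos]) simp
  also have "\<dots> = 4 * ?Z"
    unfolding d_def x_def y_def z_def by algebra
  finally show False
    using Z by simp
qed

section \<open>Case A\<close>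

text \<open>
  The forms of these three in the coordinates of the whole cone
  \<open>c \<le> b \<le> a \<le> b + c\<close> already have nonnegative coefficients.\<close>

lemma numerators_nonneg_caseA:
  fixes r u :: real
  assumes "0 < r" "r \<le> 1" "u \<le> 1" "1 \<le> r + r*u"
  shows "0 \<le> 4*r^4*u^3 + 6*r^4*u^2 + 2*r^4*u + r^3*u^2 + 3*r^3*u + 3*r^3 - r^2*u^2 - 4*r^2*u
             - 2*r^2 - r*u + 1"
      (is "0 \<le> ?n28")
    and "0 \<le> - 2*r^4*u^3 - 6*r^4*u^2 - 6*r^4*u - 2*r^4 + 2*r^3*u^3 + 5*r^3*u^2 + 5*r^3*u
             + r^3 - r^2*u^2 + 2*r^2*u + 2*r^2 + 3*r*u + 2*r - 1"
      (is "0 \<le> ?n37")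
    and "0 \<le> 4*r^4*u^2 + 4*r^4*u + 2*r^4 - 4*r^3*u^3 - 3*r^3*u^2 - 3*r^3*u - 3*r^3
             + 5*r^2*u^2 + 6*r^2*u + 2*r^2 + r*u + 2*r - 1"
      (is "0 \<le> ?n40")
proof -
  define x where "x = 1 - r"
  define y where "y = r + r*u - 1"
  define z where "z = r - r*u"
  have nonneg: "0 \<le> x" "0 \<le> y" "0 \<le> z"
    using assms by (simp_all add: x_def y_def z_def)
  have "?n28 =
      6*x^4 + 25*x^3*y + 21*x^3*z + 50*x^2*y^2 + 57*x^2*y*z + 23*x^2*z^2 + 42*x*y^3
      + 64*x*y^2*z + 37*x*y*z^2 + 11*x*z^3 + 12*y^4 + 24*y^3*z + 18*y^2*z^2 + 8*y*z^3
      + 2*z^4"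
    unfolding x_def y_def z_def by algebra
  also have "0 \<le> \<dots>"
    using nonneg by simp
  finally show "0 \<le> ?n28" .
  have "?n37 =
      46*x^4 + 131*x^3*y + 89*x^3*z + 126*x^2*y^2 + 183*x^2*y*z + 63*x^2*z^2 + 46*x*y^3
      + 108*x*y^2*z + 83*x*y*z^2 + 19*x*z^3 + 4*y^4 + 16*y^3*z + 22*y^2*z^2 + 12*y*z^3
      + 2*z^4"
    unfolding x_def y_def z_def by algebra
  also have "0 \<le> \<dots>"
    using nonneg by simp
  finally show "0 \<le> ?n37" .
  have "?n40 =
      44*x^4 + 133*x^3*y + 91*x^3*z + 142*x^2*y^2 + 213*x^2*y*z + 65*x^2*z^2 + 66*x*y^3
      + 160*x*y^2*z + 105*x*y*z^2 + 19*x*z^3 + 12*y^4 + 40*y^3*z + 42*y^2*z^2 + 16*y*z^3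
      + 2*z^4"
    unfolding x_def y_def z_def by algebra
  also have "0 \<le> \<dots>"
    using nonneg by simp
  finally show "0 \<le> ?n40" .
qed

text \<open>
  The sign conditions on \<open>B3\<close>, \<open>X\<close> and \<open>Y\<close> are those of the weights of policies 2, 26
  and 33.\<close>

lemma equalizing_mixture_caseA:
  fixes r u B3 X Y :: real
  defines "B3 \<equiv> r^2*u^2 + r^2*u - r^2 + r*u + r - 1"
    and "X \<equiv> r^2*u^2 + 3*r^2*u + r^2 - 2*r*u^2 - r*u + r - 1"
    and "Y \<equiv> - 2*r^4*u^3 - 6*r^4*u^2 - 2*r^4*u + 2*r^4 + 2*r^3*u^3 - r^3*u^2 - 5*r^3*u - r^3
          + r^2*u^2 + 2*r^2*u + 2*r^2 + r*u + 2*r + 1"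
  assumes "0 < r" "r \<le> 1" "0 < u" "u \<le> 1"
    and "1 \<le> r + r*u"
    and "B3 \<ge> 0" "X \<ge> 0" "Y \<ge> 0"
  shows "has_equalizing_mixture 1 r (r*u)
    {policy2, policy26, policy28, policy33, policy37, policy40}"
proof -
  define n2 where "n2 = 2*r*(1 + u)*(1 + r) * B3"
  define n26 where "n26 = 2*r*(1 + r) * X"
  define n28 where "n28 =
      4*r^4*u^3 + 6*r^4*u^2 + 2*r^4*u + r^3*u^2 + 3*r^3*u + 3*r^3 - r^2*u^2 - 4*r^2*u
      - 2*r^2 - r*u + 1"
  define n33 where "n33 = Y"
  define n37 where "n37 =
      - 2*r^4*u^3 - 6*r^4*u^2 - 6*r^4*u - 2*r^4 + 2*r^3*u^3 + 5*r^3*u^2 + 5*r^3*u + r^3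
      - r^2*u^2 + 2*r^2*u + 2*r^2 + 3*r*u + 2*r - 1"
  define n40 where "n40 =
      4*r^4*u^2 + 4*r^4*u + 2*r^4 - 4*r^3*u^3 - 3*r^3*u^2 - 3*r^3*u - 3*r^3 + 5*r^2*u^2
      + 6*r^2*u + 2*r^2 + r*u + 2*r - 1"
  define k where "k = 2*r*(1 + u)*(1 + r)"
  define ws where "ws =
       [(policy2, n2), (policy26, n26), (policy28, n28),
        (policy33, n33), (policy37, n37), (policy40, n40)]"
  note n_defs = n2_def n26_def n28_def n33_def n37_def n40_def
  have "0 \<le> n28" "0 \<le> n37" "0 \<le> n40"
    unfolding n_defs using numerators_nonneg_caseA[of r u] assms by simp_all
  moreover have "0 \<le> n2" "0 \<le> n26" "0 \<le> n33"
    unfolding n_defs using assms(4-) by simp_all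
  moreover have "0 < k"
    unfolding k_def using assms(4-) by (simp add: add_pos_nonneg)
  moreover have "0 < T2 1 r (r*u)"
    unfolding T2_relative using assms(4-) by (simp add: add_pos_pos)
  moreover have "n2 + n26 + n28 + n33 + n37 + n40 = k * T2 1 r (r*u)"
    unfolding n_defs k_def T2_relative B3_def X_def Y_def by algebra
  moreover have "\<forall>i<6. (\<Sum>(s, n)\<leftarrow>ws. n * costs 1 r (r*u) s ! i) = 2 * k * T3 1 r (r*u)"
    unfolding all_less_6 T3_relative ws_def
    by (intro conjI; simp add: policy_costs; unfold n_defs k_def B3_def X_def Y_def; algebra)
  ultimately show ?thesis
    by (intro equalizing_mixtureI[where k = k and ws = ws]) (simp_all add: ws_def)
qed

section \<open>Case B\<close>

text \<open>
  On the cone cut out by \<open>Y \<le> 0\<close> the coordinate \<open>b + c - a\<close> is replaced by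
  \<open>(b + c - a) - 3 * (a - b) - 2 * (b - c) = 2*b + 3*c - 4*a\<close>.\<close>

lemma numerators_nonneg_caseB:
  fixes r u :: real
  assumes "0 < r" "r \<le> 1" "u \<le> 1" "0 \<le> 2*r + 3*r*u - 4"
  shows "0 \<le> - 3*r^4*u^3 - 2*r^4*u^2 - r^4 + 3*r^3*u^3 - 3*r^3*u - r^3 + 8*r^2*u^2 + 7*r^2*u
             - 2*r^2 + 4*r*u + 3*r - 1"
      (is "0 \<le> ?n2")
    and "0 \<le> 3*r^4*u^3 - r^4*u^4 + 6*r^4*u^2 + r^4*u - r^4 - 2*r^3*u^3 + 5*r^3*u^2 + 7*r^3*u
             - 2*r^2*u^2 - 3*r*u - 3*r - 2"
      (is "0 \<le> ?n3")
    and "0 \<le> 2*r^4*u^3 - r^4*u^4 - r^4*u + 2*r^4 + r^3*u^3 + 7*r^3*u^2 + 4*r^3*u - r^3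
             - 2*r^2*u^2 + 3*r^2*u + 4*r^2 - 3*r*u - 2*r - 1"
      (is "0 \<le> ?n22")
    and "0 \<le> r^4*u^3 + 3*r^4 - r^3*u^3 + 2*r^3*u^2 - r^3*u + 5*r^3 - 4*r^2*u^2 - r^2*u
             + 4*r^2 - 6*r*u + 3*r - 1"
      (is "0 \<le> ?n26")
    and "0 \<le> 2*r^3*u^3 - r^4*u^3 - 4*r^4*u^2 - 4*r^4*u - r^4 + 2*r^3*u^2 - r^3*u + 2*r^2*u^2
             + 2*r^2*u + 4*r^2 + 2*r*u + 3*r + 4"
      (is "0 \<le> ?n37")
    and "0 \<le> r^4*u^4 - 2*r^4*u^3 + 2*r^4*u^2 + 7*r^4*u - 2*r^3*u^3 - 11*r^3*u^2 + 2*r^3*u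
             + 2*r^3 + 2*r^2*u^2 - 2*r^2*u - 2*r^2 + 11*r*u + 2*r + 4"
      (is "0 \<le> ?n40")
proof -
  define x where "x = 1 - r"
  define y where "y = 2*r + 3*r*u - 4"
  define z where "z = r - r*u"
  have nonneg: "0 \<le> x" "0 \<le> y" "0 \<le> z"
    using assms by (simp_all add: x_def y_def z_def)
  have "?n2 =
      6219*x^4 + 5315*x^3*y + 13497*x^3*z + 1684*x^2*y^2 + 8597*x^2*y*z + 10839*x^2*z^2
      + 234*x*y^3 + 1802*x*y^2*z + 4567*x*y*z^2 + 3798*x*z^3 + 12*y^4 + 124*y^3*z
      + 474*y^2*z^2 + 792*y*z^3 + 486*z^4"
    unfolding x_def y_def z_def by algebra
  also have "0 \<le> \<dots>"
    using nonneg by simp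
  finally show "0 \<le> ?n2" .
  have "?n3 =
      198*x^4 + 818*x^3*y + 1197*x^3*z + 496*x^2*y^2 + 1981*x^2*y*z + 1553*x^2*z^2
      + 108*x*y^3 + 714*x*y^2*z + 1411*x*y*z^2 + 737*x*z^3 + 8*y^4 + 74*y^3*z
      + 240*y^2*z^2 + 309*y*z^3 + 116*z^4"
    unfolding x_def y_def z_def by algebra
  also have "0 \<le> \<dots>"
    using nonneg by simp
  finally show "0 \<le> ?n3" .
  have "?n22 =
      2907*x^4 + 3031*x^3*y + 7824*x^3*z + 1160*x^2*y^2 + 6026*x^2*y*z + 7788*x^2*z^2
      + 194*x*y^3 + 1520*x*y^2*z + 3952*x*y*z^2 + 3417*x*z^3 + 12*y^4 + 126*y^3*z
      + 494*y^2*z^2 + 859*y*z^3 + 560*z^4"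
    unfolding x_def y_def z_def by algebra
  also have "0 \<le> \<dots>"
    using nonneg by simp
  finally show "0 \<le> ?n22" .
  have "?n26 =
      99*x^4 + 409*x^3*y + 2685*x^3*z + 248*x^2*y^2 + 2379*x^2*y*z + 4833*x^2*z^2
      + 54*x*y^3 + 666*x*y^2*z + 2513*x*y*z^2 + 3004*x*z^3 + 4*y^4 + 60*y^3*z
      + 322*y^2*z^2 + 744*y*z^3 + 630*z^4"
    unfolding x_def y_def z_def by algebra
  also have "0 \<le> \<dots>"
    using nonneg by simp
  finally show "0 \<le> ?n26" .
  have "?n37 =
      6600*x^4 + 5357*x^3*y + 15461*x^3*z + 1607*x^2*y^2 + 9318*x^2*y*z + 13589*x^2*z^2
      + 210*x*y^3 + 1839*x*y^2*z + 5400*x*y*z^2 + 5313*x*z^3 + 10*y^4 + 118*y^3*z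
      + 525*y^2*z^2 + 1043*y*z^3 + 780*z^4"
    unfolding x_def y_def z_def by algebra
  also have "0 \<le> \<dots>"
    using nonneg by simp
  finally show "0 \<le> ?n37" .
  have "?n40 =
      7368*x^4 + 6117*x^3*y + 18280*x^3*z + 1909*x^2*y^2 + 11523*x^2*y*z + 17130*x^2*z^2
      + 266*x*y^3 + 2431*x*y^2*z + 7287*x*y*z^2 + 7166*x*z^3 + 14*y^4 + 172*y^3*z
      + 779*y^2*z^2 + 1542*y*z^3 + 1126*z^4"
    unfolding x_def y_def z_def by algebra
  also have "0 \<le> \<dots>"
    using nonneg by simp
  finally show "0 \<le> ?n40" .
qed

text \<open>
  In contrast to the other cases, no weight is a multiple of a polynomial that delimits the
  cases: the linear consequence of \<open>Y \<le> 0\<close> controls the signs of all six.\<close>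

lemma equalizing_mixture_caseB:
  fixes r u :: real
  assumes "0 < r" "r \<le> 1" "0 < u" "u \<le> 1"
    and "0 \<le> 2*r + 3*r*u - 4"
  shows "has_equalizing_mixture 1 r (r*u)
    {policy2, policy3, policy22, policy26, policy37, policy40}"
proof -
  define n2 where "n2 =
      - 3*r^4*u^3 - 2*r^4*u^2 - r^4 + 3*r^3*u^3 - 3*r^3*u - r^3 + 8*r^2*u^2 + 7*r^2*u
      - 2*r^2 + 4*r*u + 3*r - 1"
  define n3 where "n3 =
      3*r^4*u^3 - r^4*u^4 + 6*r^4*u^2 + r^4*u - r^4 - 2*r^3*u^3 + 5*r^3*u^2 + 7*r^3*u
      - 2*r^2*u^2 - 3*r*u - 3*r - 2"
  define n22 where "n22 =
      2*r^4*u^3 - r^4*u^4 - r^4*u + 2*r^4 + r^3*u^3 + 7*r^3*u^2 + 4*r^3*u - r^3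
      - 2*r^2*u^2 + 3*r^2*u + 4*r^2 - 3*r*u - 2*r - 1"
  define n26 where "n26 =
      r^4*u^3 + 3*r^4 - r^3*u^3 + 2*r^3*u^2 - r^3*u + 5*r^3 - 4*r^2*u^2 - r^2*u + 4*r^2
      - 6*r*u + 3*r - 1"
  define n37 where "n37 =
      2*r^3*u^3 - r^4*u^3 - 4*r^4*u^2 - 4*r^4*u - r^4 + 2*r^3*u^2 - r^3*u + 2*r^2*u^2
      + 2*r^2*u + 4*r^2 + 2*r*u + 3*r + 4"
  define n40 where "n40 =
      r^4*u^4 - 2*r^4*u^3 + 2*r^4*u^2 + 7*r^4*u - 2*r^3*u^3 - 11*r^3*u^2 + 2*r^3*u + 2*r^3
      + 2*r^2*u^2 - 2*r^2*u - 2*r^2 + 11*r*u + 2*r + 4"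
  define k where "k = 3 + 3*r + 2*r*u + 2*r^2 + r^2*u*(1 - u)"
  define ws where "ws =
       [(policy2, n2), (policy3, n3), (policy22, n22),
        (policy26, n26), (policy37, n37), (policy40, n40)]"
  note n_defs = n2_def n3_def n22_def n26_def n37_def n40_def
  have "0 \<le> n2" "0 \<le> n3" "0 \<le> n22" "0 \<le> n26" "0 \<le> n37" "0 \<le> n40"
    unfolding n_defs using numerators_nonneg_caseB[of r u] assms by simp_all
  moreover have "0 < k"
    unfolding k_def using assms(1-) by (simp add: add_pos_nonneg)
  moreover have "0 < T2 1 r (r*u)"
    unfolding T2_relative using assms(1-) by (simp add: add_pos_pos)
  moreover have "n2 + n3 + n22 + n26 + n37 + n40 = k * T2 1 r (r*u)"
    unfolding n_defs k_def T2_relative by algebra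
  moreover have "\<forall>i<6. (\<Sum>(s, n)\<leftarrow>ws. n * costs 1 r (r*u) s ! i) = 2 * k * T3 1 r (r*u)"
    unfolding all_less_6 T3_relative ws_def
    by (intro conjI; simp add: policy_costs; unfold n_defs k_def; algebra)
  ultimately show ?thesis
    by (intro equalizing_mixtureI[where k = k and ws = ws]) (simp_all add: ws_def)
qed

section \<open>Case C\<close>

text \<open>
  On the cone cut out by \<open>X \<le> 0\<close> the coordinate \<open>a - b\<close> is replaced by
  \<open>2 * (a - b) - (b + c - a) - 2 * (b - c) = 3*a - 5*b + c\<close>.  Clearing the powers of \<open>2\<close> that the
  change of coordinates brings in explains the factors in front of the numerators.\<close>

lemma numerators_nonneg_caseC_cut:
  fixes r u :: real
  assumes "0 < r" "u \<le> 1" "1 \<le> r + r*u" "0 \<le> 3 - 5*r + r*u"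
  shows "0 \<le> 3*r^4*u^3 + 2*r^4*u + r^4 + 2*r^3*u^3 - r^3*u - r^2*u^2 - r^2*u - 3*r^2 + r*u
             + 1"
      (is "0 \<le> ?n28")
    and "0 \<le> r^2*u^2 - r^4*u^3 - 2*r^4*u^2 - r^4 - 2*r^3*u^2 - r^3*u - 2*r^3 + r^2*u - r^2
             + 3*r*u + 1"
      (is "0 \<le> ?n33")
proof -
  define x where "x = 3 - 5*r + r*u"
  define y where "y = r + r*u - 1"
  define z where "z = r - r*u"
  have nonneg: "0 \<le> x" "0 \<le> y" "0 \<le> z"
    using assms by (simp_all add: x_def y_def z_def)
  have "8 * ?n28 =
      6*x^4 + 47*x^3*y + 54*x^3*z + 149*x^2*y^2 + 296*x^2*y*z + 166*x^2*z^2 + 237*x*y^3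
      + 598*x*y^2*z + 536*x*y*z^2 + 188*x*z^3 + 161*y^4 + 484*y^3*z + 498*y^2*z^2
      + 220*y*z^3 + 40*z^4"
    unfolding x_def y_def z_def by algebra
  also have "0 \<le> \<dots>"
    using nonneg by simp
  finally show "0 \<le> ?n28" by simp
  have "8 * ?n33 =
      15*x^4 + 113*x^3*y + 154*x^3*z + 293*x^2*y^2 + 840*x^2*y*z + 570*x^2*z^2 + 283*x*y^3
      + 1354*x*y^2*z + 1960*x*y*z^2 + 876*x*z^3 + 56*y^4 + 540*y^3*z + 1390*y^2*z^2
      + 1356*y*z^3 + 440*z^4"
    unfolding x_def y_def z_def by algebra
  also have "0 \<le> \<dots>"
    using nonneg by simp
  finally show "0 \<le> ?n33" by simp
qed

lemma numerators_nonneg_caseC_triangle: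
  fixes r u :: real
  assumes "0 < r" "r \<le> 1" "u \<le> 1" "1 \<le> r + r*u"
  shows "0 \<le> 2*r^4*u - r^4*u^3 + r^4 + 3*r^3*u + 2*r^3 - r^2*u^2 + r^2*u + r^2 + r*u - 1"
      (is "0 \<le> ?n37")
    and "0 \<le> 2*r^4*u^2 - r^4*u^3 - r^4 - 2*r^3*u^3 + 2*r^3*u^2 + 3*r^3*u + r^2*u^2 + 3*r^2*u
             + 3*r^2 - r*u - 1"
      (is "0 \<le> ?n40")
proof -
  define x where "x = 1 - r"
  define y where "y = r + r*u - 1"
  define z where "z = r - r*u"
  have nonneg: "0 \<le> x" "0 \<le> y" "0 \<le> z"
    using assms by (simp_all add: x_def y_def z_def)
  have "?n37 =
      8*x^4 + 43*x^3*y + 34*x^3*z + 64*x^2*y^2 + 112*x^2*y*z + 41*x^2*z^2 + 38*x*y^3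
      + 104*x*y^2*z + 84*x*y*z^2 + 19*x*z^3 + 8*y^4 + 30*y^3*z + 38*y^2*z^2 + 19*y*z^3
      + 3*z^4"
    unfolding x_def y_def z_def by algebra
  also have "0 \<le> \<dots>"
    using nonneg by simp
  finally show "0 \<le> ?n37" .
  have "?n40 =
      10*x^4 + 53*x^3*y + 38*x^3*z + 76*x^2*y^2 + 116*x^2*y*z + 35*x^2*z^2 + 42*x*y^3
      + 100*x*y^2*z + 64*x*y*z^2 + 11*x*z^3 + 8*y^4 + 26*y^3*z + 26*y^2*z^2 + 9*y*z^3
      + z^4"
    unfolding x_def y_def z_def by algebra
  also have "0 \<le> \<dots>"
    using nonneg by simp
  finally show "0 \<le> ?n40" .
qed

text \<open>
  The sign conditions on \<open>Z\<close> and \<open>X\<close> are those of the weights of policies 2 and 5; on the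
  curve \<open>X = 0\<close> the weight of policy 5 vanishes here and that of policy 26 vanishes in case A.\<close>

lemma equalizing_mixture_caseC:
  fixes r u Z X :: real
  defines "Z \<equiv> r^2*u^2 + r^2*u + r^2 - r*u + r - 1"
    and "X \<equiv> r^2*u^2 + 3*r^2*u + r^2 - 2*r*u^2 - r*u + r - 1"
  assumes "0 < r" "r \<le> 1" "0 < u" "u \<le> 1"
    and "1 \<le> r + r*u"
    and "0 \<le> 3 - 5*r + r*u"
    and "Z \<ge> 0" "X \<le> 0"
  shows "has_equalizing_mixture 1 r (r*u)
    {policy2, policy5, policy28, policy33, policy37, policy40}"
proof -
  define n2 where "n2 = 2*r*(1 + u)*(1 + r) * Z"
  define n5 where "n5 = 2*r*(1 + r) * (- X)"
  define n28 where "n28 =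
      3*r^4*u^3 + 2*r^4*u + r^4 + 2*r^3*u^3 - r^3*u - r^2*u^2 - r^2*u - 3*r^2 + r*u + 1"
  define n33 where "n33 =
      r^2*u^2 - r^4*u^3 - 2*r^4*u^2 - r^4 - 2*r^3*u^2 - r^3*u - 2*r^3 + r^2*u - r^2
      + 3*r*u + 1"
  define n37 where "n37 =
      2*r^4*u - r^4*u^3 + r^4 + 3*r^3*u + 2*r^3 - r^2*u^2 + r^2*u + r^2 + r*u - 1"
  define n40 where "n40 =
      2*r^4*u^2 - r^4*u^3 - r^4 - 2*r^3*u^3 + 2*r^3*u^2 + 3*r^3*u + r^2*u^2 + 3*r^2*u
      + 3*r^2 - r*u - 1"
  define k where "k = 2*r*u*(1 + r)"
  define ws where "ws =
       [(policy2, n2), (policy5, n5), (policy28, n28),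
        (policy33, n33), (policy37, n37), (policy40, n40)]"
  note n_defs = n2_def n5_def n28_def n33_def n37_def n40_def
  have "0 \<le> n28" "0 \<le> n33"
    unfolding n_defs using numerators_nonneg_caseC_cut[of r u] assms by simp_all
  moreover have "0 \<le> n37" "0 \<le> n40"
    unfolding n_defs using numerators_nonneg_caseC_triangle[of r u] assms by simp_all
  moreover have "0 \<le> n2"
    unfolding n_defs using assms(3-) by simp_all
  moreover have "0 \<le> n5"
    unfolding n_defs by (intro mult_nonneg_nonneg) (use assms(3-) in simp_all)
  moreover have "0 < k"
    unfolding k_def using assms(3-) by (simp add: add_pos_nonneg)
  moreover have "0 < T2 1 r (r*u)"
    unfolding T2_relative using assms(3-) by (simp add: add_pos_pos)
  moreover have "n2 + n5 + n28 + n33 + n37 + n40 = k * T2 1 r (r*u)"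
    unfolding n_defs k_def T2_relative Z_def X_def by algebra
  moreover have "\<forall>i<6. (\<Sum>(s, n)\<leftarrow>ws. n * costs 1 r (r*u) s ! i) = 2 * k * T3 1 r (r*u)"
    unfolding all_less_6 T3_relative ws_def
    by (intro conjI; simp add: policy_costs; unfold n_defs k_def Z_def X_def; algebra)
  ultimately show ?thesis
    by (intro equalizing_mixtureI[where k = k and ws = ws]) (simp_all add: ws_def)
qed

section \<open>Case D\<close>

text \<open>
  On the cone cut out by \<open>Z \<le> 0\<close> the coordinate \<open>a - b\<close> is replaced by
  \<open>2 * (a - b) - 4 * (b + c - a) - 3 * (b - c) = 6*a - 9*b - c\<close>, and the factor 16 has the same
  origin as in case C.\<close>

lemma numerators_nonneg_caseD_cut:
  fixes r u :: real
  assumes "0 < r" "u \<le> 1" "1 \<le> r + r*u" "0 \<le> 6 - 9*r - r*u"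
  shows "0 \<le> 3*r^4*u^4 - r^4*u^3 - r^4*u - r^4 + 2*r^3*u^4 - r^3*u^3 - 2*r^3*u^2 - 2*r^3*u
             - 2*r^3 - r^2*u^3 - 2*r^2*u + r*u^2 + r*u + r + u"
      (is "0 \<le> ?n28")
    and "0 \<le> 2*r^3*u^2 - r^4*u^4 - r^4*u^3 - r^4*u - r^4 - r^3*u^3 - 2*r^3 - r^2*u^3
             + 2*r^2*u^2 + 2*r^2*u + r*u^2 + r*u + r - u"
      (is "0 \<le> ?n37")
proof -
  define x where "x = 6 - 9*r - r*u"
  define y where "y = r + r*u - 1"
  define z where "z = r - r*u"
  have nonneg: "0 \<le> x" "0 \<le> y" "0 \<le> z"
    using assms by (simp_all add: x_def y_def z_def)
  have "16 * (r * ?n28) =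
      9*x^5 + 219*x^4*y + 148*x^4*z + 2094*x^3*y^2 + 2782*x^3*y*z + 932*x^3*z^2
      + 9784*x^2*y^3 + 18998*x^2*y^2*z + 12420*x^2*y*z^2 + 2726*x^2*z^3 + 22160*x*y^4
      + 55072*x*y^3*z + 51770*x*y^2*z^2 + 21770*x*y*z^3 + 3435*x*z^4 + 19200*y^5
      + 55632*y^4*z + 64232*y^3*z^2 + 36786*y^2*z^3 + 10313*y*z^4 + 1102*z^5"
    unfolding x_def y_def z_def by algebra
  also have "0 \<le> \<dots>"
    using nonneg by simp
  finally show "0 \<le> ?n28"
    using \<open>0 < r\<close> by (simp add: zero_le_mult_iff)
  have "16 * (r * ?n37) =
      7*x^5 + 195*x^4*y + 146*x^4*z + 2154*x^3*y^2 + 3226*x^3*y*z + 1184*x^3*z^2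
      + 11792*x^2*y^3 + 26514*x^2*y^2*z + 19448*x^2*y*z^2 + 4658*x^2*z^3 + 31984*x*y^4
      + 96032*x*y^3*z + 105646*x*y^2*z^2 + 50494*x*y*z^3 + 8849*x*z^4 + 34368*y^5
      + 129264*y^4*z + 189680*y^3*z^2 + 135750*y^2*z^3 + 47357*y*z^4 + 6436*z^5"
    unfolding x_def y_def z_def by algebra
  also have "0 \<le> \<dots>"
    using nonneg by simp
  finally show "0 \<le> ?n37"
    using \<open>0 < r\<close> by (simp add: zero_le_mult_iff)
qed

lemma numerators_nonneg_caseD_triangle:
  fixes r u :: real
  assumes "0 < r" "r \<le> 1" "u \<le> 1" "1 \<le> r + r*u"
  shows "0 \<le> 2*r^4*u^2 - r^4*u^4 - r^4*u^3 + r^4*u + r^4 + r^3*u^3 + 4*r^3*u^2 + 4*r^3*u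
             + 4*r^3 + 3*r^2*u^3 + 2*r^2*u^2 + 2*r^2*u + 4*r^2 + r*u^2 - 3*r*u - r - u - 2"
      (is "0 \<le> ?n33")
    and "0 \<le> 3*r^4*u^3 - r^4*u^4 + 2*r^4*u^2 + r^4*u + r^4 - 2*r^3*u^4 + 3*r^3*u^3
             + 4*r^3*u^2 + 2*r^3*u + 2*r^3 + r^2*u^3 + 2*r^2*u^2 + 2*r^2*u - r*u^2 - r*u - r
             - u"
      (is "0 \<le> ?n40")
proof -
  define x where "x = 1 - r"
  define y where "y = r + r*u - 1"
  define z where "z = r - r*u"
  have nonneg: "0 \<le> x" "0 \<le> y" "0 \<le> z"
    using assms by (simp_all add: x_def y_def z_def)
  have "r * ?n33 =
      75*x^4*y + 11*x^4*z + 221*x^3*y^2 + 217*x^3*y*z + 55*x^3*z^2 + 240*x^2*y^3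
      + 444*x^2*y^2*z + 282*x^2*y*z^2 + 69*x^2*z^3 + 114*x*y^4 + 314*x*y^3*z
      + 326*x*y^2*z^2 + 161*x*y*z^3 + 34*x*z^4 + 20*y^5 + 74*y^4*z + 108*y^3*z^2
      + 81*y^2*z^3 + 33*y*z^4 + 6*z^5"
    unfolding x_def y_def z_def by algebra
  also have "0 \<le> \<dots>"
    using nonneg by simp
  finally show "0 \<le> ?n33"
    using \<open>0 < r\<close> by (simp add: zero_le_mult_iff)
  have "r * ?n40 =
      4*x^5 + 59*x^4*y + 31*x^4*z + 159*x^3*y^2 + 185*x^3*y*z + 45*x^3*z^2 + 174*x^2*y^3
      + 324*x^2*y^2*z + 174*x^2*y*z^2 + 31*x^2*z^3 + 86*x*y^4 + 224*x*y^3*z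
      + 194*x*y^2*z^2 + 73*x*y*z^3 + 12*x*z^4 + 16*y^5 + 54*y^4*z + 66*y^3*z^2
      + 39*y^2*z^3 + 13*y*z^4 + 2*z^5"
    unfolding x_def y_def z_def by algebra
  also have "0 \<le> \<dots>"
    using nonneg by simp
  finally show "0 \<le> ?n40"
    using \<open>0 < r\<close> by (simp add: zero_le_mult_iff)
qed

text \<open>
  The sign conditions on \<open>A3\<close> and \<open>Z\<close> are those of the weights of policies 5 and 19.\<close>

lemma equalizing_mixture_caseD:
  fixes r u A3 Z :: real
  defines "A3 \<equiv> r^2*u^4 + 2*r^2*u^3 + r^2*u^2 + 2*r^2*u + r^2 + r*u^3 + r - u^2 - u - 1"
    and "Z \<equiv> r^2*u^2 + r^2*u + r^2 - r*u + r - 1"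
  assumes "0 < r" "r \<le> 1" "0 < u" "u \<le> 1"
    and "1 \<le> r + r*u"
    and "0 \<le> 6 - 9*r - r*u"
    and "A3 \<ge> 0" "Z \<le> 0"
  shows "has_equalizing_mixture 1 r (r*u)
    {policy5, policy19, policy28, policy33, policy37, policy40}"
proof -
  define n5 where "n5 = 2*r*(1 + r) * A3"
  define n19 where "n19 = 2*(1 + u)*(1 + r)^2 * (- Z)"
  define n28 where "n28 =
      3*r^4*u^4 - r^4*u^3 - r^4*u - r^4 + 2*r^3*u^4 - r^3*u^3 - 2*r^3*u^2 - 2*r^3*u
      - 2*r^3 - r^2*u^3 - 2*r^2*u + r*u^2 + r*u + r + u"
  define n33 where "n33 =
      2*r^4*u^2 - r^4*u^4 - r^4*u^3 + r^4*u + r^4 + r^3*u^3 + 4*r^3*u^2 + 4*r^3*u + 4*r^3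
      + 3*r^2*u^3 + 2*r^2*u^2 + 2*r^2*u + 4*r^2 + r*u^2 - 3*r*u - r - u - 2"
  define n37 where "n37 =
      2*r^3*u^2 - r^4*u^4 - r^4*u^3 - r^4*u - r^4 - r^3*u^3 - 2*r^3 - r^2*u^3 + 2*r^2*u^2
      + 2*r^2*u + r*u^2 + r*u + r - u"
  define n40 where "n40 =
      3*r^4*u^3 - r^4*u^4 + 2*r^4*u^2 + r^4*u + r^4 - 2*r^3*u^4 + 3*r^3*u^3 + 4*r^3*u^2
      + 2*r^3*u + 2*r^3 + r^2*u^3 + 2*r^2*u^2 + 2*r^2*u - r*u^2 - r*u - r - u"
  define k where "k = 2*r*u^2*(1 + r)"
  define ws where "ws =
       [(policy5, n5), (policy19, n19), (policy28, n28),
        (policy33, n33), (policy37, n37), (policy40, n40)]"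
  note n_defs = n5_def n19_def n28_def n33_def n37_def n40_def
  have "0 \<le> n28" "0 \<le> n37"
    unfolding n_defs using numerators_nonneg_caseD_cut[of r u] assms by simp_all
  moreover have "0 \<le> n33" "0 \<le> n40"
    unfolding n_defs using numerators_nonneg_caseD_triangle[of r u] assms by simp_all
  moreover have "0 \<le> n5"
    unfolding n_defs using assms(3-) by simp_all
  moreover have "0 \<le> n19"
    unfolding n_defs by (intro mult_nonneg_nonneg) (use assms(3-) in simp_all)
  moreover have "0 < k"
    unfolding k_def using assms(3-) by (simp add: add_pos_nonneg)
  moreover have "0 < T2 1 r (r*u)"
    unfolding T2_relative using assms(3-) by (simp add: add_pos_pos)
  moreover have "n5 + n19 + n28 + n33 + n37 + n40 = k * T2 1 r (r*u)"
    unfolding n_defs k_def T2_relative A3_def Z_def by algebra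
  moreover have "\<forall>i<6. (\<Sum>(s, n)\<leftarrow>ws. n * costs 1 r (r*u) s ! i) = 2 * k * T3 1 r (r*u)"
    unfolding all_less_6 T3_relative ws_def
    by (intro conjI; simp add: policy_costs; unfold n_defs k_def A3_def Z_def; algebra)
  ultimately show ?thesis
    by (intro equalizing_mixtureI[where k = k and ws = ws]) (simp_all add: ws_def)
qed

section \<open>Assembling the cases\<close>

theorem lemma3:
  fixes r u A3 B3 X Y Z :: real
  assumes r: "0 < r" "r \<le> 1"
    and u: "0 < u" "u \<le> 1"
    and A3: "A3 = r^2*u^4 + 2*r^2*u^3 + r^2*u^2 + 2*r^2*u + r^2 + r*u^3 + r - u^2 - u - 1"
    and B3: "B3 = r^2*u^2 + r^2*u - r^2 + r*u + r - 1"
    and X: "X = r^2*u^2 + 3*r^2*u + r^2 - 2*r*u^2 - r*u + r - 1"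
    and Y: "Y = - 2*r^4*u^3 - 6*r^4*u^2 - 2*r^4*u + 2*r^4 + 2*r^3*u^3 - r^3*u^2 - 5*r^3*u
              - r^3 + r^2*u^2 + 2*r^2*u + 2*r^2 + r*u + 2*r + 1"
    and Z: "Z = r^2*u^2 + r^2*u + r^2 - r*u + r - 1"
    and A3_nonneg: "A3 \<ge> 0"
    and B3_nonneg: "B3 \<ge> 0"
  shows
    "((Y \<ge> 0 \<and> X \<ge> 0) \<or> Y \<le> 0 \<or> (Y \<ge> 0 \<and> X \<le> 0 \<and> Z \<ge> 0) \<or> (Y \<ge> 0 \<and> X \<le> 0 \<and> Z \<le> 0))
     \<and> (Y \<ge> 0 \<and> X \<ge> 0 \<longrightarrow>
          has_equalizing_mixture 1 r (r*u)
            {policy2, policy26, policy28, policy33, policy37, policy40})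
     \<and> (Y \<le> 0 \<longrightarrow>
          has_equalizing_mixture 1 r (r*u)
            {policy2, policy3, policy22, policy26, policy37, policy40})
     \<and> (Y \<ge> 0 \<and> X \<le> 0 \<and> Z \<ge> 0 \<longrightarrow>
          has_equalizing_mixture 1 r (r*u)
            {policy2, policy5, policy28, policy33, policy37, policy40})
     \<and> (Y \<ge> 0 \<and> X \<le> 0 \<and> Z \<le> 0 \<longrightarrow>
          has_equalizing_mixture 1 r (r*u)
            {policy5, policy19, policy28, policy33, policy37, policy40})"
proof -
  have triangle: "1 \<le> r + r*u"
    using triangle_inequality[OF r(1) u] A3_nonneg B3_nonneg unfolding A3 B3 .
  have "0 \<le> 2*r + 3*r*u - 4" if "Y \<le> 0"
    using cut_of_Y_nonpos[OF r u(2) triangle] that unfolding Y .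
  moreover have "0 \<le> 3 - 5*r + r*u" if "X \<le> 0"
    using cut_of_X_nonpos[OF r u(2) triangle] that unfolding X .
  moreover have "0 \<le> 6 - 9*r - r*u" if "Z \<le> 0"
    using cut_of_Z_nonpos[OF r u(2) triangle] that unfolding Z .
  ultimately show ?thesis
    using equalizing_mixture_caseA[OF r u triangle, folded B3 X Y]
      equalizing_mixture_caseB[OF r u]
      equalizing_mixture_caseC[OF r u triangle, folded Z X]
      equalizing_mixture_caseD[OF r u triangle, folded A3 Z]
      A3_nonneg B3_nonneg linear[of 0 X] linear[of 0 Y] linear[of 0 Z]
    by blast
qed

end
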